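(* Let $N\ge 1$ and $n\ge 1$ be integers, let $\mu$ be a probability measure on the totally ordered set $\{1<2<\cdots<N\}$, and let $f_1,\ldots,f_n:\{1,\ldots,N\}\to\mathbb{R}$ be nonnegative monotone nondecreasing functions. Then $$E_n(f_1,\ldots,f_n)=\sum_{\lambda\vdash n}c_\lambda E_\lambda\ \ge\ 0,\qquad\text{where } c_\lambda=(-1)^{\ell+1}\prod_{i=1}^{\ell}(\lambda_i-1)!\ \text{ for } \lambda=(\lambda_1,\ldots,\lambda_\ell).$$
   Context: For a function $f:\{1,\ldots,N\}\to\mathbb{R}$, write $\langle f\rangle_\mu=\sum_{j=1}^N\mu(j)f(j)$ for its expectation with respect to $\mu$. Given $f_1,\ldots,f_n$ and a subset $\delta\subseteq[n]=\{1,\ldots,n\}$, put $E_\delta=\left\langle\prod_{i\in\delta}f_i\right\rangle_\mu$ (expectation of the pointwise product). For a set partition $\sigma=\{\sigma_1,\ldots,\sigma_\ell\}$ of $[n]$ into disjoint nonempty subsets, put $E_\sigma=\prod_{i=1}^{\ell}E_{\sigma_i}$, and let $\lambda(\sigma)=(\lambda_1,\ldots,\lambda_\ell)$ be the integer partition of $n$ formed by the block sizes $\lambda_i=|\sigma_i|$, with the blocks indexed so that $\lambda_1\ge\cdots\ge\lambda_\ell$. For an integer partition $\lambda$ of $n$ (written $\lambda\vdash n$), put $E_\lambda=\sum_{\sigma:\,\lambda(\sigma)=\lambda}E_\sigma$, the sum over all set partitions $\sigma$ of $[n]$ with $\lambda(\sigma)=\lambda$. The number of parts of $\lambda$ is denoted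 $\ell$. *)

theory Defs
  imports "HOL-Probability.Probability_Mass_Function" "HOL-Library.Multiset"
    "HOL-Library.Disjoint_Sets"
begin

text \<open>
  A probability measure on $\{1,\dots,N\}$ is a \<^typ>\<open>nat pmf\<close> whose support is contained in
  \<^term>\<open>{1..N}\<close>. Functions on $\{1,\dots,N\}$ are functions on \<^typ>\<open>nat\<close> of which only the
  values on \<^term>\<open>{1..N}\<close> are ever used, and a family $f_1,\dots,f_n$ is a function of its index.
\<close>

definition expect :: "nat \<Rightarrow> nat pmf \<Rightarrow> (nat \<Rightarrow> real) \<Rightarrow> real" where
  "expect N \<mu> g = (\<Sum>j = 1..N. pmf \<mu> j * g j)"

definition E_subset :: "nat \<Rightarrow> nat pmf \<Rightarrow> (nat \<Rightarrow> nat \<Rightarrow> real) \<Rightarrow> nat set \<Rightarrow> real" where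
  "E_subset N \<mu> f \<delta> = expect N \<mu> (\<lambda>j. \<Prod>i\<in>\<delta>. f i j)"

definition E_setpart :: "nat \<Rightarrow> nat pmf \<Rightarrow> (nat \<Rightarrow> nat \<Rightarrow> real) \<Rightarrow> nat set set \<Rightarrow> real" where
  "E_setpart N \<mu> f \<sigma> = (\<Prod>B\<in>\<sigma>. E_subset N \<mu> f B)"

definition is_int_partition :: "nat list \<Rightarrow> nat \<Rightarrow> bool" (infix "\<turnstile>" 50) where
  "ps \<turnstile> n \<longleftrightarrow> sorted_wrt (\<ge>) ps \<and> (\<forall>p\<in>set ps. p > 0) \<and> sum_list ps = n"

definition shape :: "nat set set \<Rightarrow> nat list" where
  "shape \<sigma> = rev (sorted_list_of_multiset (image_mset card (mset_set \<sigma>)))"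

definition E_intpart :: "nat \<Rightarrow> nat pmf \<Rightarrow> nat \<Rightarrow> (nat \<Rightarrow> nat \<Rightarrow> real) \<Rightarrow> nat list \<Rightarrow> real" where
  "E_intpart N \<mu> n f ps = (\<Sum>\<sigma> | partition_on {1..n} \<sigma> \<and> shape \<sigma> = ps. E_setpart N \<mu> f \<sigma>)"

definition c_coeff :: "nat list \<Rightarrow> real" where
  "c_coeff ps = (-1) ^ (length ps + 1) * (\<Prod>i<length ps. fact (ps ! i - 1))"

definition E_n :: "nat \<Rightarrow> nat pmf \<Rightarrow> nat \<Rightarrow> (nat \<Rightarrow> nat \<Rightarrow> real) \<Rightarrow> real" where
  "E_n N \<mu> n f = (\<Sum>ps | ps \<turnstile> n. c_coeff ps * E_intpart N \<mu> n f ps)"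

text \<open>The index sets of the sums above are finite, so none of them collapses to \<open>0\<close>.\<close>

lemma finite_int_partitions: "finite {ps. ps \<turnstile> n}"
proof (rule finite_subset)
  have len: "length xs \<le> sum_list xs" if "\<forall>p\<in>set xs. p > 0" for xs :: "nat list"
    using that by (induction xs) auto
  show "{ps. ps \<turnstile> n} \<subseteq> {xs. set xs \<subseteq> {..n} \<and> length xs \<le> n}"
    using len by (auto simp: is_int_partition_def dest: member_le_sum_list)
  show "finite {xs. set xs \<subseteq> {..n} \<and> length xs \<le> n}"
    by (rule finite_lists_length_le) simp
qed

lemma finite_set_partitions: "finite {\<sigma>. partition_on {1..n::nat} \<sigma> \<and> shape \<sigma> = ps}"
  by (rule finite_subset[of _ "Pow (Pow {1..n})"]) (auto simp: partition_on_def)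

lemma shape_is_int_partition:
  assumes "partition_on {1..n} \<sigma>"
  shows "shape \<sigma> \<turnstile> n"
proof -
  have fin: "finite \<sigma>"
    using assms finite_elements by blast
  have finB: "finite B" "B \<noteq> {}" if "B \<in> \<sigma>" for B
    using assms that by (auto simp: partition_on_def intro!: finite_subset[of B "{1..n}"])
  have "sum_list (shape \<sigma>) = sum_mset (mset (shape \<sigma>))"
    by (simp only: sum_mset_sum_list)
  also have "\<dots> = sum card \<sigma>"
    by (simp add: shape_def sum_unfold_sum_mset)
  also have "\<dots> = card (\<Union>\<sigma>)"
    using assms finB by (intro card_Union_disjoint[symmetric])
      (auto simp: partition_on_def disjoint_def pairwise_def disjnt_def)
  also have "\<dots> = n"
    using assms by (simp add: partition_on_def)
  finally have "sum_list (shape \<sigma>) = n" .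
  moreover have "sorted_wrt (\<ge>) (shape \<sigma>)"
    by (simp add: shape_def sorted_wrt_rev)
  moreover have "\<forall>p\<in>set (shape \<sigma>). p > 0"
    using fin finB by (auto simp: shape_def card_gt_0_iff)
  ultimately show ?thesis
    by (simp add: is_int_partition_def)
qed

end

theory Submission
  imports Defs
begin

text \<open>
  Unfolding the sum over integer partitions, $-E_n$ is the sum, over all set partitions $\sigma$ of
  $[n]$, of the product over the blocks $B$ of $-(|B|-1)!\,E_B$.  Since there are $(|B|-1)!$ cyclic
  orders on $B$, this is also a sum over permutations in which every cycle $c$ contributes $-E_c$.

  This sum is linear in each $f_i$ separately, because exactly one block of $\sigma$ contains $i$.  A
  nonnegative nondecreasing function on $\{1,\dots,N\}$ is a nonnegative combination of indicators
  of the up-sets $\{k,\dots,N\}$, so it suffices to treat the case where every $f_i$ is such an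
  indicator, say of the set $U_i$ of measure $x_i$.  The $U_i$ form a chain, whence $E_B$ is the
  measure of the smallest $U_i$ with $i\in B$.  Add the indices one at a time in the order of
  increasing $x_i$.  A new index $m$ either forms a block of its own, which contributes the factor
  $-x_m$, or joins an existing block $B$; in the latter case $E_B$ does not change and the factorial
  produces the factor $|B|$.  As the block sizes add up to the number of indices already present, the
  sum is multiplied by $(m-1)-x_m$ when $m$ is the $m$-th index, and therefore
  $$E_n = x_1\,(1-x_2)\,(2-x_3)\cdots(n-1-x_n)\ \ge\ 0.$$
  The recursion is lemma \<open>cycle_sum_insert\<close>, the sign for indicators \<open>cycle_sum_up_sets_le_0\<close>, and the
  reduction to indicators rests on \<open>cycle_sum_linear\<close> and \<open>layer_cake_nat\<close>.
\<close>

section \<open>Adding an element to a set partition\<close>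

text \<open>
  The permissible \<open>B = {}\<close> stands for making \<open>{m}\<close> a block of its own.  Allowing it as a choice
  alongside the blocks of \<open>\<sigma>\<close> is what turns this map into a bijection.
\<close>

definition insert_in_block :: "'a \<Rightarrow> 'a set set \<Rightarrow> 'a set \<Rightarrow> 'a set set" where
  "insert_in_block m \<sigma> B = insert (insert m B) (\<sigma> - {B})"

lemma partition_on_insert_in_block:
  assumes "partition_on A \<sigma>" "m \<notin> A" "B \<in> insert {} \<sigma>"
  shows "partition_on (insert m A) (insert_in_block m \<sigma> B)"
proof (rule partition_onI)
  show "{} \<notin> insert_in_block m \<sigma> B"
    using assms(1) by (auto simp: insert_in_block_def partition_on_def)
  show "\<Union> (insert_in_block m \<sigma> B) = insert m A"
    using assms by (auto simp: insert_in_block_def partition_on_def)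
  have "m \<notin> p" if "p \<in> \<sigma>" for p
    using assms(1,2) that by (auto simp: partition_on_def)
  then show "disjnt p q"
    if "p \<in> insert_in_block m \<sigma> B" "q \<in> insert_in_block m \<sigma> B" "p \<noteq> q" for p q
    using that assms(3) partition_onD2[OF assms(1)]
    by (auto simp: insert_in_block_def disjnt_def disjoint_def)
qed

lemma bij_betw_insert_in_block:
  assumes "m \<notin> A"
  shows "bij_betw (\<lambda>(\<sigma>, B). insert_in_block m \<sigma> B)
           (SIGMA \<sigma>:{\<sigma>. partition_on A \<sigma>}. insert {} \<sigma>) {\<tau>. partition_on (insert m A) \<tau>}"
proof (rule bij_betwI')
  fix x y
  assume x: "x \<in> (SIGMA \<sigma>:{\<sigma>. partition_on A \<sigma>}. insert {} \<sigma>)"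
    and y: "y \<in> (SIGMA \<sigma>:{\<sigma>. partition_on A \<sigma>}. insert {} \<sigma>)"
  obtain \<sigma> B \<sigma>' B' where xy: "x = (\<sigma>, B)" "y = (\<sigma>', B')"
    by (cases x, cases y)
  have \<sigma>: "partition_on A \<sigma>" "partition_on A \<sigma>'" "B \<in> insert {} \<sigma>" "B' \<in> insert {} \<sigma>'"
    using x y xy by auto
  have out: "m \<notin> p" if "p \<in> \<sigma> \<or> p \<in> \<sigma>'" for p
    using \<sigma>(1,2) assms that by (auto simp: partition_on_def)
  have ne: "{} \<notin> \<sigma>" "{} \<notin> \<sigma>'"
    using \<sigma>(1,2) by (auto simp: partition_on_def)
  show "((case x of (\<sigma>, B) \<Rightarrow> insert_in_block m \<sigma> B) = (case y of (\<sigma>, B) \<Rightarrow> insert_in_block m \<sigma> B))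
          = (x = y)"
  proof
    assume "(case x of (\<sigma>, B) \<Rightarrow> insert_in_block m \<sigma> B) = (case y of (\<sigma>, B) \<Rightarrow> insert_in_block m \<sigma> B)"
    then have eq: "insert (insert m B) (\<sigma> - {B}) = insert (insert m B') (\<sigma>' - {B'})"
      by (simp add: xy insert_in_block_def)
    \<comment> \<open>\<open>insert m B\<close> is the only block that contains \<open>m\<close>, so it can be read off from the image.\<close>
    have "insert m B = insert m B'"
      using eq out by blast
    moreover have mB: "m \<notin> B" "m \<notin> B'"
      using \<sigma>(3,4) out by auto
    ultimately have B: "B = B'"
      by (metis insert_ident)
    have "insert m B \<notin> \<sigma> - {B}" "insert m B' \<notin> \<sigma>' - {B'}"
      using out by blast+
    with eq B have rest: "\<sigma> - {B} = \<sigma>' - {B}"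
      by (metis insert_ident)
    have "\<sigma> = \<sigma>'"
    proof (cases "B = {}")
      case True
      with rest ne show ?thesis by simp
    next
      case False
      with \<sigma>(3,4) B have "B \<in> \<sigma>" "B \<in> \<sigma>'" by auto
      with rest show ?thesis by blast
    qed
    with B xy show "x = y" by simp
  qed auto
next
  fix x
  assume "x \<in> (SIGMA \<sigma>:{\<sigma>. partition_on A \<sigma>}. insert {} \<sigma>)"
  then show "(case x of (\<sigma>, B) \<Rightarrow> insert_in_block m \<sigma> B) \<in> {\<tau>. partition_on (insert m A) \<tau>}"
    using partition_on_insert_in_block[OF _ assms] by (auto split: prod.split)
next
  fix \<tau>
  assume "\<tau> \<in> {\<tau>. partition_on (insert m A) \<tau>}"
  then have \<tau>: "partition_on (insert m A) \<tau>" by simp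
  then obtain C where C: "C \<in> \<tau>" "m \<in> C"
    by (auto simp: partition_on_def)
  have disj: "C \<inter> p = {}" if "p \<in> \<tau>" "p \<noteq> C" for p
    using partition_onD2[OF \<tau>] C that by (auto simp: disjoint_def)
  have ne: "{} \<notin> \<tau>" and un: "\<Union>\<tau> = insert m A"
    using \<tau> by (auto simp: partition_on_def)
  define B where "B = C - {m}"
  define \<sigma> where "\<sigma> = (\<tau> - {C}) \<union> ({B} - {{}})"
  have mB: "insert m B = C" "m \<notin> B" using C by (auto simp: B_def)
  have outm: "m \<notin> p" if "p \<in> \<tau> - {C}" for p
    using disj that C by auto
  have "B \<notin> \<tau> - {C}"
  proof
    assume B: "B \<in> \<tau> - {C}"
    then have "C \<inter> B = {}" using disj by auto
    then have "B = {}" using B_def by auto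
    with B ne show False by simp
  qed
  then have img: "insert_in_block m \<sigma> B = \<tau>"
    using C(1) mB ne by (auto simp: insert_in_block_def \<sigma>_def)
  have "partition_on A \<sigma>"
  proof (rule partition_onI)
    show "{} \<notin> \<sigma>"
      using ne by (auto simp: \<sigma>_def)
    have "\<Union>\<sigma> = \<Union>(\<tau> - {C}) \<union> B"
      by (auto simp: \<sigma>_def)
    also have "\<dots> = (\<Union>\<tau>) - {m}"
      using outm C by (auto simp: B_def)
    finally show "\<Union>\<sigma> = A"
      using un assms by auto
    have "disjnt p q" if "p \<in> \<tau>" "q \<in> \<tau>" "p \<noteq> q" for p q
      using partition_onD2[OF \<tau>] that by (simp add: pairwise_def)
    moreover have "disjnt p B" "disjnt B p" if "p \<in> \<tau> - {C}" for p
      using disj[of p] that by (auto simp: B_def disjnt_def)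
    ultimately show "disjnt p q" if "p \<in> \<sigma>" "q \<in> \<sigma>" "p \<noteq> q" for p q
      using that unfolding \<sigma>_def by blast
  qed
  moreover have "B \<in> insert {} \<sigma>"
    by (auto simp: \<sigma>_def)
  ultimately show "\<exists>x\<in>SIGMA \<sigma>:{\<sigma>. partition_on A \<sigma>}. insert {} \<sigma>.
      \<tau> = (case x of (\<sigma>, B) \<Rightarrow> insert_in_block m \<sigma> B)"
    using img by (intro bexI[of _ "(\<sigma>, B)"]) auto
qed

section \<open>The sum over permutations, grouped by cycle supports\<close>

text \<open>
  The factor \<open>fact (card B - 1)\<close> counts the cyclic permutations with support \<open>B\<close>, so this is the sum
  over all permutations of \<open>A\<close> of the product of \<open>- w c\<close> over the supports \<open>c\<close> of their cycles, fixed
  points included.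
\<close>

definition cycle_sum :: "('a set \<Rightarrow> real) \<Rightarrow> 'a set \<Rightarrow> real" where
  "cycle_sum w A = (\<Sum>\<sigma> | partition_on A \<sigma>. \<Prod>B\<in>\<sigma>. - (fact (card B - 1) * w B))"

lemma cycle_sum_empty: "cycle_sum w {} = 1"
proof -
  have "{\<sigma>. partition_on {} \<sigma>} = {{} :: 'a set set}"
    by (auto simp: partition_on_def)
  then show ?thesis by (simp add: cycle_sum_def)
qed

text \<open>
  In terms of permutations: a new element is either a fixed point or is spliced into a cycle directly
  after one of the \<open>card A\<close> old elements.  The hypothesis says that splicing does not change the
  weight of the cycle.
\<close>

lemma cycle_sum_insert:
  assumes fin: "finite A" and m: "m \<notin> A"
    and w: "\<And>B. B \<subseteq> A \<Longrightarrow> B \<noteq> {} \<Longrightarrow> w (insert m B) = w B"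
  shows "cycle_sum w (insert m A) = (real (card A) - w {m}) * cycle_sum w A"
proof -
  define v where "v B = - (fact (card B - 1) * w B)" for B
  have cycle_sum_v: "cycle_sum w X = (\<Sum>\<sigma> | partition_on X \<sigma>. prod v \<sigma>)" for X
    by (simp add: cycle_sum_def v_def)
  have step: "(\<Sum>B\<in>insert {} \<sigma>. prod v (insert_in_block m \<sigma> B))
                = (real (card A) - w {m}) * prod v \<sigma>"
    if \<sigma>: "partition_on A \<sigma>" for \<sigma>
  proof -
    have fin\<sigma>: "finite \<sigma>" using finite_elements[OF fin \<sigma>] .
    have ne: "{} \<notin> \<sigma>" and sub: "\<And>B. B \<in> \<sigma> \<Longrightarrow> B \<subseteq> A"
      using \<sigma> by (auto simp: partition_on_def)
    have card_A: "card A = (\<Sum>B\<in>\<sigma>. card B)"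
      using product_partition[OF \<sigma>] fin sub finite_subset by blast
    have new: "prod v (insert_in_block m \<sigma> B) = v (insert m B) * prod v (\<sigma> - {B})" for B
      using fin\<sigma> m sub by (subst insert_in_block_def, subst prod.insert) auto
    have "prod v (insert_in_block m \<sigma> B) = real (card B) * prod v \<sigma>" if B: "B \<in> \<sigma>" for B
    proof -
      have finB: "finite B" "B \<noteq> {}" "m \<notin> B"
        using sub[OF B] fin m ne B finite_subset by auto
      then have "fact (card B) = real (card B) * fact (card B - 1)"
        by (intro fact_reduce) (simp add: card_gt_0_iff)
      then have "v (insert m B) = real (card B) * v B"
        using finB w[OF sub[OF B]] by (simp add: v_def)
      then show ?thesis
        by (simp add: new prod.remove[OF fin\<sigma> B])
    qed
    then have "(\<Sum>B\<in>\<sigma>. prod v (insert_in_block m \<sigma> B)) = real (\<Sum>B\<in>\<sigma>. card B) * prod v \<sigma>"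
      by (simp add: sum_distrib_right)
    moreover have "prod v (insert_in_block m \<sigma> {}) = - w {m} * prod v \<sigma>"
      using ne by (simp add: new) (simp add: v_def)
    ultimately show ?thesis
      using fin\<sigma> ne card_A by (simp add: algebra_simps)
  qed
  have "cycle_sum w (insert m A)
      = (\<Sum>(\<sigma>, B)\<in>(SIGMA \<sigma>:{\<sigma>. partition_on A \<sigma>}. insert {} \<sigma>). prod v (insert_in_block m \<sigma> B))"
    unfolding cycle_sum_v
    by (subst sum.reindex_bij_betw[OF bij_betw_insert_in_block[OF m], symmetric])
      (simp add: case_prod_unfold)
  also have "\<dots> = (\<Sum>\<sigma> | partition_on A \<sigma>. \<Sum>B\<in>insert {} \<sigma>. prod v (insert_in_block m \<sigma> B))"
    using fin by (subst sum.Sigma) (auto simp: finitely_many_partition_on intro: finite_elements)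
  also have "\<dots> = (\<Sum>\<sigma> | partition_on A \<sigma>. (real (card A) - w {m}) * prod v \<sigma>)"
    by (intro sum.cong step) auto
  finally show ?thesis
    by (simp add: cycle_sum_v sum_distrib_left)
qed

section \<open>Indicators of up-sets\<close>

lemma expect_nonneg:
  assumes "\<And>j. j \<in> {1..N} \<Longrightarrow> 0 \<le> g j"
  shows "0 \<le> expect N \<mu> g"
  using assms by (auto simp: expect_def intro!: sum_nonneg)

lemma expect_le_1:
  assumes "\<And>j. j \<in> {1..N} \<Longrightarrow> g j \<le> 1"
  shows "expect N \<mu> g \<le> 1"
proof -
  have "expect N \<mu> g \<le> (\<Sum>j = 1..N. pmf \<mu> j)"
    unfolding expect_def using assms by (intro sum_mono) (simp add: mult_left_le)
  also have "\<dots> = measure (measure_pmf \<mu>) {1..N}"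
    by (simp add: measure_measure_pmf_finite)
  finally show ?thesis
    using measure_pmf.prob_le_1[of \<mu> "{1..N}"] by linarith
qed

text \<open>
  The indices are added in the order of decreasing thresholds \<open>k\<close>, that is, of increasing up-sets:
  then the up-set of the new index contains all earlier ones and does not change their
  intersections.
  The first index contributes a factor \<open>\<le> 0\<close>, every later one a factor \<open>\<ge> 0\<close>.
\<close>

lemma cycle_sum_up_sets_le_0:
  assumes "finite A" "A \<noteq> {}" and f: "\<And>i. i \<in> A \<Longrightarrow> f i = (\<lambda>j. of_bool (k i \<le> j))"
  shows "cycle_sum (E_subset N \<mu> f) A \<le> 0"
  using assms
proof (induction A rule: finite_ranking_induct[where f = "\<lambda>i. - int (k i)"])
  case empty
  then show ?case by simp
next
  case (insert m S)
  have ind: "f i = (\<lambda>j. of_bool (k i \<le> j))" if "i \<in> insert m S" for i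
    using insert.prems that by blast
  show ?case
  proof (cases "m \<in> S")
    case True
    then have "insert m S = S" by blast
    with insert show ?thesis by auto
  next
    case False
    let ?w = "E_subset N \<mu> f"
    have "?w (insert m B) = ?w B" if B: "B \<subseteq> S" "B \<noteq> {}" for B
    proof -
      obtain i where i: "i \<in> B" using B by blast
      have finB: "finite B" "m \<notin> B" using B insert.hyps(1) False finite_subset by auto
      have absorb: "f m j * (\<Prod>i\<in>B. f i j) = (\<Prod>i\<in>B. f i j)" for j
      proof (cases "k m \<le> j")
        case True
        then show ?thesis by (simp add: ind)
      next
        case False
        moreover have "k m \<le> k i" using insert.hyps(2) i B by force
        ultimately have "f i j = 0" using i B by (auto simp: ind)
        then have "(\<Prod>i\<in>B. f i j) = 0" using i finB by (auto intro: prod_zero)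
        then show ?thesis by simp
      qed
      show ?thesis by (simp only: E_subset_def prod.insert[OF finB] absorb)
    qed
    then have rec: "cycle_sum ?w (insert m S) = (real (card S) - ?w {m}) * cycle_sum ?w S"
      using insert.hyps(1) False by (intro cycle_sum_insert)
    have w0: "0 \<le> ?w {m}" and w1: "?w {m} \<le> 1"
      by (auto simp: E_subset_def ind intro!: expect_nonneg expect_le_1)
    show ?thesis
    proof (cases "S = {}")
      case True
      with rec w0 show ?thesis by (simp add: cycle_sum_empty)
    next
      case S: False
      then have "1 \<le> card S" using insert.hyps(1) by (simp add: Suc_le_eq card_gt_0_iff)
      then have "0 \<le> real (card S) - ?w {m}" using w1 by linarith
      moreover have "cycle_sum ?w S \<le> 0" using insert.IH S ind by blast
      ultimately show ?thesis by (simp add: rec mult_nonneg_nonpos)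
    qed
  qed
qed

section \<open>Reduction to up-sets by multilinearity\<close>

lemma E_subset_linear:
  assumes "finite B" "i \<in> B" and "\<And>j. j \<in> {1..N} \<Longrightarrow> f i j = (\<Sum>k\<in>K. a k * h k j)"
  shows "E_subset N \<mu> f B = (\<Sum>k\<in>K. a k * E_subset N \<mu> (f(i := h k)) B)"
proof -
  have upd: "(\<Prod>l\<in>B. (f(i := h k)) l j) = h k j * (\<Prod>l\<in>B - {i}. f l j)" for k j
    using assms(1,2) by (simp add: prod.remove)
  have "E_subset N \<mu> f B = (\<Sum>j = 1..N. pmf \<mu> j * ((\<Sum>k\<in>K. a k * h k j) * (\<Prod>l\<in>B - {i}. f l j)))"
    using assms by (simp add: E_subset_def expect_def prod.remove)
  also have "\<dots> = (\<Sum>j = 1..N. \<Sum>k\<in>K. a k * (pmf \<mu> j * (h k j * (\<Prod>l\<in>B - {i}. f l j))))"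
    by (simp add: sum_distrib_left sum_distrib_right mult_ac)
  also have "\<dots> = (\<Sum>k\<in>K. \<Sum>j = 1..N. a k * (pmf \<mu> j * (h k j * (\<Prod>l\<in>B - {i}. f l j))))"
    by (rule sum.swap)
  finally show ?thesis
    by (simp only: E_subset_def expect_def upd sum_distrib_left)
qed

lemma cycle_sum_linear:
  assumes fin: "finite A" and i: "i \<in> A"
    and f: "\<And>j. j \<in> {1..N} \<Longrightarrow> f i j = (\<Sum>k\<in>K. a k * h k j)"
  shows "cycle_sum (E_subset N \<mu> f) A = (\<Sum>k\<in>K. a k * cycle_sum (E_subset N \<mu> (f(i := h k))) A)"
proof -
  define v where "v g B = - (fact (card B - 1) * E_subset N \<mu> g B)" for g B
  have cycle_sum_v: "cycle_sum (E_subset N \<mu> g) A = (\<Sum>\<sigma> | partition_on A \<sigma>. prod (v g) \<sigma>)" for g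
    by (simp add: cycle_sum_def v_def)
  have "prod (v f) \<sigma> = (\<Sum>k\<in>K. a k * prod (v (f(i := h k))) \<sigma>)" if \<sigma>: "partition_on A \<sigma>" for \<sigma>
  proof -
    have fin\<sigma>: "finite \<sigma>" using finite_elements[OF fin \<sigma>] .
    obtain C where C: "C \<in> \<sigma>" "i \<in> C" using \<sigma> i by (auto simp: partition_on_def)
    have "finite C" using \<sigma> C fin by (auto simp: partition_on_def intro: finite_subset)
    then have "v f C = (\<Sum>k\<in>K. a k * v (f(i := h k)) C)"
      using E_subset_linear[where f = f, OF _ C(2) f]
      by (simp add: v_def sum_distrib_left mult_ac flip: sum_negf)
    moreover have "prod (v (f(i := h k))) (\<sigma> - {C}) = prod (v f) (\<sigma> - {C})" for k
    proof (rule prod.cong[OF refl])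
      fix B assume "B \<in> \<sigma> - {C}"
      then have "i \<notin> B" using C partition_onD2[OF \<sigma>] by (auto simp: disjoint_def)
      then have "(\<Prod>l\<in>B. (f(i := h k)) l j) = (\<Prod>l\<in>B. f l j)" for j
        by (intro prod.cong) auto
      then show "v (f(i := h k)) B = v f B" by (simp only: v_def E_subset_def)
    qed
    ultimately show ?thesis
      by (simp add: prod.remove[OF fin\<sigma> C(1)] sum_distrib_right mult.assoc)
  qed
  then have "(\<Sum>\<sigma> | partition_on A \<sigma>. prod (v f) \<sigma>)
      = (\<Sum>\<sigma> | partition_on A \<sigma>. \<Sum>k\<in>K. a k * prod (v (f(i := h k))) \<sigma>)"
    by simp
  also have "\<dots> = (\<Sum>k\<in>K. \<Sum>\<sigma> | partition_on A \<sigma>. a k * prod (v (f(i := h k))) \<sigma>)"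
    by (rule sum.swap)
  finally show ?thesis
    by (simp only: cycle_sum_v sum_distrib_left)
qed

lemma layer_cake_nat:
  fixes g :: "nat \<Rightarrow> real"
  assumes "j \<in> {1..N}"
  shows "g j = (\<Sum>k = 1..N. (g k - (if k = 1 then 0 else g (k - 1))) * of_bool (k \<le> j))"
proof -
  have "(\<Sum>k = 1..Suc i. g k - (if k = 1 then 0 else g (k - 1))) = g (Suc i)" for i
    by (induction i) auto
  moreover obtain i where "j = Suc i"
    using assms by (cases j) auto
  ultimately have "g j = (\<Sum>k = 1..j. g k - (if k = 1 then 0 else g (k - 1)))"
    by metis
  also have "\<dots> = (\<Sum>k = 1..N. (g k - (if k = 1 then 0 else g (k - 1))) * of_bool (k \<le> j))"
    using assms by (intro sum.mono_neutral_cong_left) auto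
  finally show ?thesis .
qed

text \<open>
  The functions with index in \<open>S\<close> are still general nonnegative nondecreasing ones, the others are
  already indicators of up-sets; the induction step expands one general function into its layers,
  whose coefficients are nonnegative because the function is nonnegative and nondecreasing.
\<close>

lemma cycle_sum_monotone_le_0:
  assumes fin: "finite A" and "A \<noteq> {}" and "finite S" "S \<subseteq> A"
    and "\<And>i j. i \<in> S \<Longrightarrow> j \<in> {1..N} \<Longrightarrow> f i j \<ge> 0"
    and "\<And>i. i \<in> S \<Longrightarrow> mono_on {1..N} (f i)"
    and "\<And>i. i \<in> A - S \<Longrightarrow> \<exists>k. f i = (\<lambda>j. of_bool (k \<le> j))"
  shows "cycle_sum (E_subset N \<mu> f) A \<le> 0"
  using assms(3-)
proof (induction S arbitrary: f rule: finite_induct)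
  case empty
  then obtain k where "\<And>i. i \<in> A \<Longrightarrow> f i = (\<lambda>j. of_bool (k i \<le> j))"
    by (metis Diff_empty)
  then show ?case
    using cycle_sum_up_sets_le_0 assms(1,2) by blast
next
  case (insert i S)
  let ?a = "\<lambda>k. f i k - (if k = 1 then 0 else f i (k - 1))"
  let ?h = "\<lambda>k j. of_bool (k \<le> j) :: real"
  have "?a k * cycle_sum (E_subset N \<mu> (f(i := ?h k))) A \<le> 0" if k: "k \<in> {1..N}" for k
  proof (rule mult_nonneg_nonpos)
    show "0 \<le> ?a k"
      using k insert.prems(2)[of i k] insert.prems(3)[of i]
      by (auto elim!: mono_onD)
    show "cycle_sum (E_subset N \<mu> (f(i := ?h k))) A \<le> 0"
      using insert.prems insert.hyps by (intro insert.IH) auto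
  qed
  moreover have "cycle_sum (E_subset N \<mu> f) A
      = (\<Sum>k = 1..N. ?a k * cycle_sum (E_subset N \<mu> (f(i := ?h k))) A)"
    using insert.prems(1) by (intro cycle_sum_linear fin layer_cake_nat) auto
  ultimately show ?case
    by (simp only: sum_nonpos)
qed

section \<open>From integer partitions to set partitions\<close>

lemma c_coeff_shape:
  assumes "finite \<sigma>"
  shows "c_coeff (shape \<sigma>) = - (\<Prod>B\<in>\<sigma>. - fact (card B - 1))"
proof -
  have len: "length (shape \<sigma>) = card \<sigma>"
    by (simp add: shape_def flip: size_mset)
  have "(\<Prod>i<length (shape \<sigma>). fact (shape \<sigma> ! i - 1) :: real)
      = prod_list (map (\<lambda>p. fact (p - 1)) (shape \<sigma>))"
    by (simp add: prod.list_conv_set_nth atLeast0LessThan)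
  also have "\<dots> = prod_mset (image_mset (\<lambda>p. fact (p - 1)) (mset (shape \<sigma>)))"
    by (simp only: prod_mset_prod_list flip: mset_map)
  also have "\<dots> = (\<Prod>B\<in>\<sigma>. fact (card B - 1))"
    by (simp add: shape_def prod_unfold_prod_mset image_mset.compositionality comp_def)
  finally show ?thesis
    by (simp add: c_coeff_def len prod_uminus)
qed

lemma E_n_eq_cycle_sum: "E_n N \<mu> n f = - cycle_sum (E_subset N \<mu> f) {1..n}"
proof -
  let ?P = "{\<sigma>. partition_on {1..n} \<sigma>}"
  have "E_n N \<mu> n f = (\<Sum>ps | ps \<turnstile> n. \<Sum>\<sigma> | \<sigma> \<in> ?P \<and> shape \<sigma> = ps. c_coeff (shape \<sigma>) * E_setpart N \<mu> f \<sigma>)"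
    by (simp add: E_n_def E_intpart_def sum_distrib_left)
  also have "\<dots> = (\<Sum>\<sigma>\<in>?P. c_coeff (shape \<sigma>) * E_setpart N \<mu> f \<sigma>)"
    using shape_is_int_partition
    by (intro sum.group finite_int_partitions finitely_many_partition_on) auto
  also have "\<dots> = (\<Sum>\<sigma>\<in>?P. - (\<Prod>B\<in>\<sigma>. - (fact (card B - 1) * E_subset N \<mu> f B)))"
  proof (rule sum.cong[OF refl])
    fix \<sigma> assume "\<sigma> \<in> ?P"
    then have "finite \<sigma>" using finite_elements by blast
    then show "c_coeff (shape \<sigma>) * E_setpart N \<mu> f \<sigma>
        = - (\<Prod>B\<in>\<sigma>. - (fact (card B - 1) * E_subset N \<mu> f B))"
      by (simp add: c_coeff_shape E_setpart_def flip: prod.distrib)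
  qed
  finally show ?thesis
    by (simp add: cycle_sum_def sum_negf)
qed

theorem lemma1:
  fixes N n :: nat and \<mu> :: "nat pmf" and f :: "nat \<Rightarrow> nat \<Rightarrow> real"
  assumes "N \<ge> 1" and "n \<ge> 1"
    and "set_pmf \<mu> \<subseteq> {1..N}"
    and "\<And>i j. i \<in> {1..n} \<Longrightarrow> j \<in> {1..N} \<Longrightarrow> f i j \<ge> 0"
    and "\<And>i. i \<in> {1..n} \<Longrightarrow> mono_on {1..N} (f i)"
  shows "E_n N \<mu> n f \<ge> 0"
proof -
  have "cycle_sum (E_subset N \<mu> f) {1..n} \<le> 0"
    using assms(2,4,5) by (intro cycle_sum_monotone_le_0[where S = "{1..n}"]) auto
  then show ?thesis
    by (simp add: E_n_eq_cycle_sum)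
qed

end
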